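(* There is a constant $C>0$ such that for every integer $r>3$ there exists a strongly temporalisable trip network $(D_r,\mathbb{T}_r)$ with $n=r^2+2r$ nodes such that every temporalisation $\tau$ of $(D_r,\mathbb{T}_r)$ has $\tau$-reachability at most $C\,n^{3/2}$.
   Context: A weighted multidigraph $D=(V,E)$ has a finite node set $V$ and a finite multiset $E$ of edges $(u,v,w)$ with weight $w>0$. A trip network is a pair $(D,\mathbb{T})$ where $\mathbb{T}$ is a finite multiset of walks in $D$ (trips); every node and edge of $D$ appears in some trip. A temporalisation $\tau$ assigns a real starting time $\tau(T)$ to each trip. For a trip $T=e_1,\dots,e_k$ with $e_i=(u_i,v_i,w_i)$, it induces temporal edges $(u_i,v_i,\tau(T)+\sum_{j<i}w_j,w_i)$ (tail, head, starting time, travel time). The induced temporal graph $G[D,\mathbb{T},\tau]$ has node set $V$ and all temporal edges induced by all trips. A temporal path from $u$ to $v$ is a sequence of consecutive temporal edges from $u$ to $v$ in which each edge's starting time is at least the arrival time (starting time plus travel time) of the previous one; $v$ is $\tau$-reachable from $u$ if such a path exists in $G[D,\mathbb{T},\tau]$ (every node reaches itself). The $\tau$-reachability of the trip network is the number of ordered pairs $(u,v)$ of nodes with $v$ $\tau$-reachable from $u$. The trip network is strongly temporalisable if for every two nodes $s,t$ there exists a temporalisation $\tau$ (depending on $s,t$) such that $t$ is $\tau$-reachable from $s$. *)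

theory Defs
  imports Complex_Main "HOL-Library.Multiset"
begin

type_synonym 'v edge = "'v \<times> 'v \<times> real"

definition tail :: "'v edge \<Rightarrow> 'v" where "tail = (\<lambda>(u, v, w). u)"
definition head :: "'v edge \<Rightarrow> 'v" where "head = (\<lambda>(u, v, w). v)"
definition weight :: "'v edge \<Rightarrow> real" where "weight = (\<lambda>(u, v, w). w)"

record 'v multidigraph =
  nodes :: "'v set"
  edges :: "'v edge multiset"

definition weighted_multidigraph :: "'v multidigraph \<Rightarrow> bool" where
  "weighted_multidigraph D \<longleftrightarrow>
     finite (nodes D) \<and>
     (\<forall>e \<in># edges D. tail e \<in> nodes D \<and> head e \<in> nodes D \<and> weight e > 0)"

text \<open>A walk is given by its edges and has at least one of them.\<close>

definition is_walk :: "'v multidigraph \<Rightarrow> 'v edge list \<Rightarrow> bool" where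
  "is_walk D T \<longleftrightarrow>
     T \<noteq> [] \<and> set T \<subseteq> set_mset (edges D) \<and>
     (\<forall>i. Suc i < length T \<longrightarrow> head (T ! i) = tail (T ! Suc i))"

record 'v trip_net =
  graph :: "'v multidigraph"
  trips :: "'v edge list multiset"

definition trip_network :: "'v trip_net \<Rightarrow> bool" where
  "trip_network N \<longleftrightarrow>
     weighted_multidigraph (graph N) \<and>
     (\<forall>T \<in># trips N. is_walk (graph N) T) \<and>
     (\<forall>x \<in> nodes (graph N). \<exists>T \<in># trips N. \<exists>e \<in> set T. x = tail e \<or> x = head e) \<and>
     (\<forall>e \<in># edges (graph N). \<exists>T \<in># trips N. e \<in> set T)"

text \<open>
  The trips form a multiset, and each copy of a repeated trip has a starting time of its
  own: \<open>\<tau> T c\<close> is the starting time of copy \<open>c < count (trips N) T\<close> of the trip \<open>T\<close>.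
  Values of \<open>\<tau>\<close> at other arguments are never used.
\<close>

type_synonym 'v temporalisation = "'v edge list \<Rightarrow> nat \<Rightarrow> real"

text \<open>A temporal edge is a tuple (tail, head, starting time, travel time).\<close>

type_synonym 'v tedge = "'v \<times> 'v \<times> real \<times> real"

definition ttail :: "'v tedge \<Rightarrow> 'v" where "ttail = (\<lambda>(u, v, t, w). u)"
definition thead :: "'v tedge \<Rightarrow> 'v" where "thead = (\<lambda>(u, v, t, w). v)"
definition start_time :: "'v tedge \<Rightarrow> real" where "start_time = (\<lambda>(u, v, t, w). t)"
definition arrival_time :: "'v tedge \<Rightarrow> real" where "arrival_time = (\<lambda>(u, v, t, w). t + w)"

definition trip_tedges :: "'v edge list \<Rightarrow> real \<Rightarrow> 'v tedge set" where
  "trip_tedges T t =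
     {(tail (T ! i), head (T ! i), t + (\<Sum>j<i. weight (T ! j)), weight (T ! i)) | i. i < length T}"

record 'v temporal_graph =
  tnodes :: "'v set"
  tedges :: "'v tedge set"

definition induced_temporal_graph :: "'v trip_net \<Rightarrow> 'v temporalisation \<Rightarrow> 'v temporal_graph" where
  "induced_temporal_graph N \<tau> =
     \<lparr>tnodes = nodes (graph N),
      tedges = (\<Union>T \<in> set_mset (trips N). \<Union>c < count (trips N) T. trip_tedges T (\<tau> T c))\<rparr>"

definition temporal_path :: "'v temporal_graph \<Rightarrow> 'v \<Rightarrow> 'v tedge list \<Rightarrow> 'v \<Rightarrow> bool" where
  "temporal_path G u p v \<longleftrightarrow>
     p \<noteq> [] \<and> set p \<subseteq> tedges G \<and> ttail (hd p) = u \<and> thead (last p) = v \<and>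
     (\<forall>i. Suc i < length p \<longrightarrow>
        thead (p ! i) = ttail (p ! Suc i) \<and> arrival_time (p ! i) \<le> start_time (p ! Suc i))"

definition temporally_reachable :: "'v temporal_graph \<Rightarrow> 'v \<Rightarrow> 'v \<Rightarrow> bool" where
  "temporally_reachable G u v \<longleftrightarrow>
     u \<in> tnodes G \<and> v \<in> tnodes G \<and> (u = v \<or> (\<exists>p. temporal_path G u p v))"

definition reachability :: "'v trip_net \<Rightarrow> 'v temporalisation \<Rightarrow> nat" where
  "reachability N \<tau> =
     card {(u, v). u \<in> nodes (graph N) \<and> v \<in> nodes (graph N) \<and>
                   temporally_reachable (induced_temporal_graph N \<tau>) u v}"

definition strongly_temporalisable :: "'v trip_net \<Rightarrow> bool" where
  "strongly_temporalisable N \<longleftrightarrow>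
     (\<forall>s \<in> nodes (graph N). \<forall>t \<in> nodes (graph N).
        \<exists>\<tau>. temporally_reachable (induced_temporal_graph N \<tau>) s t)"

end

theory Submission imports Defs begin

text \<open>
  There are \<open>4r + 1\<close> hub nodes and \<open>r\<^sup>2 - 2r - 1\<close> outer nodes. The hub is a chain
  \<open>z\<^sub>0, \<dots>, z\<^sub>r\<close> of gates: gate \<open>t\<close> lets traffic enter \<open>z\<^sub>t\<^sub>+\<^sub>1\<close> either from \<open>z\<^sub>t\<close> or from a
  side entrance \<open>x\<^sub>t\<close>, using the two trips
  \<open>A\<^sub>t = (u\<^sub>t, z\<^sub>t\<^sub>+\<^sub>1, z\<^sub>t, v\<^sub>t)\<close> and \<open>B\<^sub>t = (v\<^sub>t, z\<^sub>t\<^sub>+\<^sub>1, x\<^sub>t, u\<^sub>t)\<close>. Passing from \<open>z\<^sub>t\<close> needs \<open>A\<^sub>t\<close> to finish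
  before \<open>B\<^sub>t\<close> starts, and passing from \<open>x\<^sub>t\<close> needs the opposite order, so in each temporalisation
  at most one side entrance leads to \<open>z\<^sub>r\<close>. An outer node \<open>s\<close> has a single outgoing edge, to
  \<open>x\<^sub>c\<close> with \<open>c = s mod r\<close>, and a single incoming edge, from \<open>z\<^sub>r\<close>. Hence, up to pairs that
  involve the hub, only the \<open>O(r)\<close> outer nodes of one residue class reach anything, which leaves
  \<open>O(r n)\<close> pairs; but every side entrance can be opened by some temporalisation.
\<close>

section \<open>Temporal paths\<close>

lemma trip_tedges_single:
  "trip_tedges [e] t = {(tail e, head e, t, weight e)}"
  by (auto simp: trip_tedges_def)

lemma trip_tedges_triple:
  "trip_tedges [e, f, g] t =
     {(tail e, head e, t, weight e), (tail f, head f, t + weight e, weight f),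
      (tail g, head g, t + weight e + weight f, weight g)}"
proof -
  have "trip_tedges T t = (\<lambda>i. (tail (T ! i), head (T ! i), t + (\<Sum>j<i. weight (T ! j)), weight (T ! i)))
      ` {..<length T}" for T :: "'a edge list"
    by (auto simp: trip_tedges_def)
  moreover have "{..<length [e, f, g]} = {0, Suc 0, Suc (Suc 0)}"
    by auto
  ultimately show ?thesis
    by (simp add: add.assoc)
qed

lemma temporal_path_snoc:
  assumes "temporal_path G a p v" "(v, w, t, d) \<in> tedges G" "arrival_time (last p) \<le> t"
  shows "temporal_path G a (p @ [(v, w, t, d)]) w"
proof -
  let ?q = "p @ [(v, w, t, d)]"
  have p: "p \<noteq> []" and last: "last p = p ! (length p - 1)"
    using assms(1) by (auto simp: temporal_path_def last_conv_nth)
  have "thead (?q ! i) = ttail (?q ! Suc i) \<and> arrival_time (?q ! i) \<le> start_time (?q ! Suc i)"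
    if "Suc i < length ?q" for i
  proof (cases "Suc i < length p")
    case True
    then show ?thesis
      using assms(1) by (simp add: temporal_path_def nth_append)
  next
    case False
    then have "i = length p - 1" and "Suc i = length p"
      using that by auto
    then show ?thesis
      using assms p last
      by (auto simp: temporal_path_def nth_append ttail_def start_time_def)
  qed
  then show ?thesis
    using assms p by (auto simp: temporal_path_def thead_def)
qed

text \<open>Carrying a deadline instead of a path lets edges be chained by comparing numbers. The
  trivial path has no arrival time, so it meets every deadline.\<close>

definition arrives_by :: "'v temporal_graph \<Rightarrow> 'v \<Rightarrow> 'v \<Rightarrow> real \<Rightarrow> bool" where
  "arrives_by G a v b \<longleftrightarrow> a = v \<or> (\<exists>p. temporal_path G a p v \<and> arrival_time (last p) \<le> b)"

lemma arrives_by_refl: "arrives_by G a a b"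
  by (simp add: arrives_by_def)

lemma arrives_by_step:
  assumes "arrives_by G a v b" "(v, w, t, d) \<in> tedges G" "b \<le> t" "t + d \<le> b'"
  shows "arrives_by G a w b'"
proof (cases "a = v")
  case True
  have "temporal_path G v [(v, w, t, d)] w"
    using assms(2) by (simp add: temporal_path_def ttail_def thead_def)
  then show ?thesis
    using True assms(4) by (force simp: arrives_by_def arrival_time_def)
next
  case False
  then obtain p where p: "temporal_path G a p v" "arrival_time (last p) \<le> b"
    using assms(1) by (auto simp: arrives_by_def)
  then have "temporal_path G a (p @ [(v, w, t, d)]) w"
    using assms by (intro temporal_path_snoc) auto
  then show ?thesis
    using assms(4) by (force simp: arrives_by_def arrival_time_def)
qed

text \<open>Induction along the path, used to show non-reachability. \<open>I\<close> sees node and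
  arrival time together; the source has no arrival time, hence the separate premise for the first
  edge.\<close>

lemma temporal_path_invariant:
  assumes path: "temporal_path G a p v"
    and first: "\<And>w t d. (a, w, t, d) \<in> tedges G \<Longrightarrow> I w (t + d)"
    and step: "\<And>x b w t d. I x b \<Longrightarrow> (x, w, t, d) \<in> tedges G \<Longrightarrow> b \<le> t \<Longrightarrow> I w (t + d)"
  shows "I v (arrival_time (last p))"
proof -
  have edge: "p ! i \<in> tedges G" if "i < length p" for i
    using path that by (auto simp: temporal_path_def)
  have "I (thead (p ! i)) (arrival_time (p ! i))" if "i < length p" for i
    using that
  proof (induction i)
    case 0
    have "ttail (p ! 0) = a"
      using path by (auto simp: temporal_path_def hd_conv_nth)
    then show ?case
      using first edge[OF 0]
      by (cases "p ! 0") (auto simp: ttail_def thead_def arrival_time_def)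
  next
    case (Suc i)
    have "thead (p ! i) = ttail (p ! Suc i)" "arrival_time (p ! i) \<le> start_time (p ! Suc i)"
      using path Suc.prems by (auto simp: temporal_path_def)
    then show ?case
      using step Suc.IH Suc.prems edge[OF Suc.prems]
      by (cases "p ! Suc i") (auto simp: ttail_def thead_def arrival_time_def start_time_def)
  qed
  moreover have "p \<noteq> []" "thead (last p) = v"
    using path by (auto simp: temporal_path_def)
  ultimately show ?thesis
    by (auto simp: last_conv_nth)
qed

section \<open>The gate network\<close>

text \<open>The hub nodes \<open>z\<^sub>t, x\<^sub>t, u\<^sub>t, v\<^sub>t\<close> are encoded as \<open>4t, 4t + 1, 4t + 2, 4t + 3\<close>.\<close>

definition trip_A :: "nat \<Rightarrow> nat edge list" where
  "trip_A t = [(4*t+2, 4*t+4, 1), (4*t+4, 4*t, 1), (4*t, 4*t+3, 1)]"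

definition trip_B :: "nat \<Rightarrow> nat edge list" where
  "trip_B t = [(4*t+3, 4*t+4, 1), (4*t+4, 4*t+1, 1), (4*t+1, 4*t+2, 1)]"

definition trip_in :: "nat \<Rightarrow> nat \<Rightarrow> nat edge list" where
  "trip_in r s = [(s, 4 * (s mod r) + 1, 1)]"

definition trip_out :: "nat \<Rightarrow> nat \<Rightarrow> nat edge list" where
  "trip_out r w = [(4*r, w, 1)]"

definition gate_trips :: "nat \<Rightarrow> nat edge list set" where
  "gate_trips r = trip_A ` {..<r} \<union> trip_B ` {..<r} \<union> trip_in r ` {4*r<..<r^2+2*r}
     \<union> trip_out r ` ({..<r^2+2*r} - {4*r})"

text \<open>Every trip occurs once, so only the starting times \<open>\<tau> T 0\<close>
  matter.\<close>

definition gate_net :: "nat \<Rightarrow> nat trip_net" where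
  "gate_net r =
     \<lparr>graph = \<lparr>nodes = {..<r^2+2*r}, edges = mset_set (\<Union>T\<in>gate_trips r. set T)\<rparr>,
      trips = mset_set (gate_trips r)\<rparr>"

lemma finite_gate_trips [simp]: "finite (gate_trips r)"
  by (simp add: gate_trips_def)

lemma hub_size:
  assumes "r > 3"
  shows "4 * r < r^2 + 2 * (r::nat)"
proof -
  have "4 * r \<le> r * r"
    using assms by (intro mult_right_mono) auto
  then show ?thesis
    using assms by (simp add: power2_eq_square)
qed

lemma trip_network_gate_net:
  assumes "r > 3"
  shows "trip_network (gate_net r)"
proof -
  have edge: "tail e < r^2+2*r \<and> head e < r^2+2*r \<and> weight e > 0"
    if "T \<in> gate_trips r" "e \<in> set T" for T e
  proof -
    have "4 * (s mod r) + 1 < 4 * r" for s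
      using assms mod_less_divisor[of r s] by linarith
    then have "4 * (s mod r) + 1 < r^2+2*r" for s
      using hub_size[OF assms] by (meson less_trans)
    then show ?thesis
      using that hub_size[OF assms]
      by (auto simp: gate_trips_def trip_A_def trip_B_def trip_in_def trip_out_def
          tail_def head_def weight_def)
  qed
  have walk: "T \<noteq> [] \<and> (\<forall>i. Suc i < length T \<longrightarrow> head (T ! i) = tail (T ! Suc i))"
    if "T \<in> gate_trips r" for T
    using that
    by (auto simp: gate_trips_def trip_A_def trip_B_def trip_in_def trip_out_def
        tail_def head_def less_Suc_eq nth_Cons split: nat.splits)
  \<comment> \<open>The outgoing trips alone cover the nodes: their common tail is
    \<open>4*r\<close> and their heads are all the others.\<close>
  have cover: "\<exists>T\<in>gate_trips r. \<exists>e\<in>set T. x = tail e \<or> x = head e" if "x < r^2+2*r" for x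
  proof (cases "x = 4*r")
    case True
    have "trip_out r 0 \<in> gate_trips r"
      using assms by (auto simp: gate_trips_def)
    then show ?thesis
      using True by (force simp: trip_out_def tail_def)
  next
    case False
    then have "trip_out r x \<in> gate_trips r"
      using that by (auto simp: gate_trips_def)
    then show ?thesis
      by (force simp: trip_out_def head_def)
  qed
  show ?thesis
    unfolding trip_network_def weighted_multidigraph_def is_walk_def gate_net_def
    using edge walk cover by auto
qed

lemma tedges_gate_net:
  "tedges (induced_temporal_graph (gate_net r) \<tau>) = (\<Union>T\<in>gate_trips r. trip_tedges T (\<tau> T 0))"
  by (auto simp: induced_temporal_graph_def gate_net_def)

lemma trip_tedges_trip_A:
  "trip_tedges (trip_A t) a =
     {(4*t+2, 4*t+4, a, 1), (4*t+4, 4*t, a+1, 1), (4*t, 4*t+3, a+2, 1)}"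
proof -
  have "a + 1 + 1 = a + 2"
    by simp
  then show ?thesis
    by (simp only: trip_A_def trip_tedges_triple tail_def head_def weight_def prod.case)
qed

lemma trip_tedges_trip_B:
  "trip_tedges (trip_B t) b =
     {(4*t+3, 4*t+4, b, 1), (4*t+4, 4*t+1, b+1, 1), (4*t+1, 4*t+2, b+2, 1)}"
proof -
  have "b + 1 + 1 = b + 2"
    by simp
  then show ?thesis
    by (simp only: trip_B_def trip_tedges_triple tail_def head_def weight_def prod.case)
qed

lemma trip_tedges_trip_in: "trip_tedges (trip_in r s) a = {(s, 4 * (s mod r) + 1, a, 1)}"
  by (simp add: trip_in_def trip_tedges_single tail_def head_def weight_def)

lemma trip_tedges_trip_out: "trip_tedges (trip_out r w) a = {(4*r, w, a, 1)}"
  by (simp add: trip_out_def trip_tedges_single tail_def head_def weight_def)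

lemmas trip_tedges_gate =
  trip_tedges_trip_A trip_tedges_trip_B trip_tedges_trip_in trip_tedges_trip_out

text \<open>Times are kept only for gate trips; for the edges from outer nodes and from the root,
  the position suffices in the invariants.\<close>

lemma gate_tedge_cases:
  assumes "(x, w, t, d) \<in> tedges (induced_temporal_graph (gate_net r) \<tau>)"
  obtains
    (A) k where "k < r" "(x, w, t, d) \<in> trip_tedges (trip_A k) (\<tau> (trip_A k) 0)"
  | (B) k where "k < r" "(x, w, t, d) \<in> trip_tedges (trip_B k) (\<tau> (trip_B k) 0)"
  | (In) "4*r < x" "w = 4 * (x mod r) + 1"
  | (Out) "x = 4*r"
  using assms unfolding tedges_gate_net gate_trips_def
  by (auto simp: trip_tedges_trip_in trip_tedges_trip_out)

section \<open>Every pair can be connected\<close>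

text \<open>
  The temporalisation that opens the side entrance of gate \<open>c\<close> and the entrance from \<open>z\<^sub>t\<close> of
  every other gate \<open>t\<close>; no side entrance is open if \<open>c \<ge> r\<close>. A trip is recognised by its length
  and its first node.
\<close>

definition gate_opening :: "nat \<Rightarrow> nat \<Rightarrow> nat temporalisation" where
  "gate_opening r c T i =
     (let p = tail (hd T) in
      if length T = 1 then (if p = 4*r then 10 * real r else -1)
      else if (p mod 4 = 2) = (p div 4 = c) then 10 * real (p div 4) + 4
      else 10 * real (p div 4))"

lemma gate_opening_A: "gate_opening r c (trip_A t) i = (if t = c then 10 * real t + 4 else 10 * real t)"
proof -
  have "(4*t+2) mod 4 = 2" "(4*t+2) div 4 = t" by presburger+
  then show ?thesis
    by (auto simp: gate_opening_def trip_A_def tail_def Let_def)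
qed

lemma gate_opening_B: "gate_opening r c (trip_B t) i = (if t = c then 10 * real t else 10 * real t + 4)"
proof -
  have "(4*t+3) mod 4 = 3" "(4*t+3) div 4 = t" by presburger+
  then show ?thesis
    by (simp add: gate_opening_def trip_B_def tail_def Let_def)
qed

lemma gate_opening_in: "4*r < s \<Longrightarrow> gate_opening r c (trip_in r s) i = -1"
  by (simp add: gate_opening_def trip_in_def tail_def)

lemma gate_opening_out: "gate_opening r c (trip_out r w) i = 10 * real r"
  by (simp add: gate_opening_def trip_out_def tail_def)

abbreviation opened :: "nat \<Rightarrow> nat \<Rightarrow> nat temporal_graph" where
  "opened r c \<equiv> induced_temporal_graph (gate_net r) (gate_opening r c)"

lemma opened_tedge:
  assumes "T \<in> gate_trips r" "e \<in> trip_tedges T (gate_opening r c T 0)"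
  shows "e \<in> tedges (opened r c)"
  using assms by (auto simp: tedges_gate_net)

text \<open>Gate \<open>t\<close> owns the times from \<open>10*t\<close> to
  \<open>10*t + 10\<close>: its first trip ends at \<open>10*t + 3\<close>, its second starts at
  \<open>10*t + 4\<close> and ends at \<open>10*t + 7\<close>.\<close>

lemma opened_z_step:
  assumes "arrives_by (opened r c) a (4*t) (10 * real t)" "t < r" "t \<noteq> c"
  shows "arrives_by (opened r c) a (4*t+3) (10 * real t + 4)"
proof (rule arrives_by_step[OF assms(1)])
  show "(4*t, 4*t+3, 10 * real t + 2, 1) \<in> tedges (opened r c)"
    using assms by (intro opened_tedge[of "trip_A t"])
      (auto simp: gate_trips_def trip_tedges_trip_A gate_opening_A)
qed auto

lemma opened_v_step:
  assumes "arrives_by (opened r c) a (4*t+3) (10 * real t + 4)" "t < r" "t \<noteq> c"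
  shows "arrives_by (opened r c) a (4 * Suc t) (10 * real (Suc t))"
proof (rule arrives_by_step[OF assms(1)])
  show "(4*t+3, 4 * Suc t, 10 * real t + 4, 1) \<in> tedges (opened r c)"
    using assms by (intro opened_tedge[of "trip_B t"])
      (auto simp: gate_trips_def trip_tedges_trip_B gate_opening_B)
qed auto

lemma opened_x_step:
  assumes "arrives_by (opened r c) a (4*c+1) (10 * real c)" "c < r"
  shows "arrives_by (opened r c) a (4*c+2) (10 * real c + 4)"
proof (rule arrives_by_step[OF assms(1)])
  show "(4*c+1, 4*c+2, 10 * real c + 2, 1) \<in> tedges (opened r c)"
    using assms by (intro opened_tedge[of "trip_B c"])
      (auto simp: gate_trips_def trip_tedges_trip_B gate_opening_B)
qed auto

lemma opened_u_step:
  assumes "arrives_by (opened r c) a (4*c+2) (10 * real c + 4)" "c < r"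
  shows "arrives_by (opened r c) a (4 * Suc c) (10 * real (Suc c))"
proof (rule arrives_by_step[OF assms(1)])
  show "(4*c+2, 4 * Suc c, 10 * real c + 4, 1) \<in> tedges (opened r c)"
    using assms by (intro opened_tedge[of "trip_A c"])
      (auto simp: gate_trips_def trip_tedges_trip_A gate_opening_A)
qed auto

text \<open>The last premise keeps gate \<open>c\<close> off the remaining chain, so each gate still
  ahead lets traffic through from its \<open>z\<close> node.\<close>

lemma opened_z_to_root:
  assumes "t \<le> r" "arrives_by (opened r c) a (4*t) (10 * real t)" "c < t \<or> c = r"
  shows "arrives_by (opened r c) a (4*r) (10 * real r)"
  using assms
proof (induction rule: inc_induct)
  case base
  then show ?case by simp
next
  case (step t)
  then have "arrives_by (opened r c) a (4 * Suc t) (10 * real (Suc t))"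
    by (intro opened_v_step opened_z_step) auto
  then show ?case
    using step by auto
qed

text \<open>The choice of \<open>c\<close> is \<open>a mod r\<close> for outer nodes, the own gate
  for \<open>x\<close> and \<open>u\<close> nodes, and \<open>r\<close> (all side entrances closed)
  for \<open>z\<close> and \<open>v\<close> nodes below the root.\<close>

lemma ex_opening_to_root:
  assumes "r > 3" "a < r^2 + 2*r"
  shows "\<exists>c. arrives_by (opened r c) a (4*r) (10 * real r)"
proof -
  consider (outer) "4*r < a" | (root) "a = 4*r" | (hub) t where "t < r" "a \<in> {4*t, 4*t+1, 4*t+2, 4*t+3}"
  proof -
    have "a \<in> {4 * (a div 4), 4 * (a div 4) + 1, 4 * (a div 4) + 2, 4 * (a div 4) + 3}"
      by simp presburger
    moreover have "a div 4 < r" if "a < 4*r"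
      using that by (simp add: less_mult_imp_div_less mult.commute)
    ultimately show ?thesis
      using that by (metis linorder_neqE_nat)
  qed
  then show ?thesis
  proof cases
    case outer
    define c where "c = a mod r"
    have c: "c < r"
      using assms by (simp add: c_def)
    \<comment> \<open>Leaving at -1 means arriving at 0, in time even for gate 0.\<close>
    have "(a, 4*c+1, -1, 1) \<in> tedges (opened r c)"
      using outer assms by (intro opened_tedge[of "trip_in r a"])
        (auto simp: gate_trips_def trip_tedges_trip_in gate_opening_in c_def)
    then have "arrives_by (opened r c) a (4*c+1) (10 * real c)"
      using arrives_by_step[OF arrives_by_refl[of _ a "-1"]] by auto
    then have "arrives_by (opened r c) a (4 * Suc c) (10 * real (Suc c))"
      using c by (intro opened_u_step opened_x_step)
    then show ?thesis
      using c opened_z_to_root[of "Suc c" r c a] by auto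
  next
    case root
    then show ?thesis
      by (simp add: arrives_by_refl)
  next
    case (hub t)
    then consider "a = 4*t" | "a = 4*t+1" | "a = 4*t+2" | "a = 4*t+3"
      by auto
    then show ?thesis
    proof cases
      case 1
      then show ?thesis
        using hub opened_z_to_root[of t r r a] arrives_by_refl[of _ a] by fastforce
    next
      case 2
      then have "arrives_by (opened r t) a (4 * Suc t) (10 * real (Suc t))"
        using hub arrives_by_refl by (intro opened_u_step opened_x_step) auto
      then show ?thesis
        using hub opened_z_to_root[of "Suc t" r t a] by auto
    next
      case 3
      then have "arrives_by (opened r t) a (4 * Suc t) (10 * real (Suc t))"
        using hub arrives_by_refl by (intro opened_u_step) auto
      then show ?thesis
        using hub opened_z_to_root[of "Suc t" r t a] by auto
    next
      case 4
      then have "arrives_by (opened r r) a (4 * Suc t) (10 * real (Suc t))"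
        using hub arrives_by_refl by (intro opened_v_step) auto
      then show ?thesis
        using hub opened_z_to_root[of "Suc t" r r a] by auto
    qed
  qed
qed

lemma strongly_temporalisable_gate_net:
  assumes "r > 3"
  shows "strongly_temporalisable (gate_net r)"
proof -
  have "\<exists>\<tau>. temporally_reachable (induced_temporal_graph (gate_net r) \<tau>) a b"
    if ab: "a < r^2+2*r" "b < r^2+2*r" for a b
  proof -
    obtain c where c: "arrives_by (opened r c) a (4*r) (10 * real r)"
      using ex_opening_to_root[OF assms ab(1)] by blast
    have "arrives_by (opened r c) a b (10 * real r + 1)"
    proof (cases "b = 4*r")
      case True
      then show ?thesis
        using c by (force simp: arrives_by_def)
    next
      case False
      show ?thesis
      proof (rule arrives_by_step[OF c])
        show "(4*r, b, 10 * real r, 1) \<in> tedges (opened r c)"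
          using False ab by (intro opened_tedge[of "trip_out r b"])
            (auto simp: gate_trips_def trip_tedges_trip_out gate_opening_out)
      qed auto
    qed
    then have "temporally_reachable (opened r c) a b"
      using ab by (auto simp: temporally_reachable_def arrives_by_def
          induced_temporal_graph_def gate_net_def)
    then show ?thesis
      by blast
  qed
  then show ?thesis
    by (auto simp: strongly_temporalisable_def gate_net_def)
qed

section \<open>Few pairs are connected simultaneously\<close>

text \<open>
  Side entrance \<open>c\<close> is useless if gate \<open>c\<close> has \<open>A\<close> before \<open>B\<close>, because one gets stuck at \<open>u\<^sub>c\<close>.
\<close>

lemma closed_side_entrance:
  assumes path: "temporal_path (induced_temporal_graph (gate_net r) \<tau>) s p w"
    and s: "4*r < s" and c: "s mod r = c" "c < r"
    and AB: "\<tau> (trip_A c) 0 + 3 \<le> \<tau> (trip_B c) 0"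
  shows "w \<le> 4*r"
proof -
  \<comment> \<open>The only edge out of \<open>4*c+2\<close> is the first one of
    \<open>trip_A c\<close>, which has left before \<open>trip_B c\<close> arrives there.\<close>
  let ?I = "\<lambda>x b. x = 4*c+1 \<or> x = 4*c+2 \<and> b \<ge> \<tau> (trip_B c) 0 + 3"
  have "?I w (arrival_time (last p))"
    using path
  proof (rule temporal_path_invariant)
    fix w t d assume "(s, w, t, d) \<in> tedges (induced_temporal_graph (gate_net r) \<tau>)"
    then show "?I w (t + d)"
      by (cases rule: gate_tedge_cases) (use s c in \<open>auto simp: trip_tedges_gate\<close>)
  next
    fix x b w t d
    assume I: "?I x b" and b: "b \<le> t"
      and "(x, w, t, d) \<in> tedges (induced_temporal_graph (gate_net r) \<tau>)"
    have x: "x = 4*c+1 \<or> x = 4*c+2"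
      using I by auto
    from \<open>(x, w, t, d) \<in> _\<close> show "?I w (t + d)"
    proof (cases rule: gate_tedge_cases)
      case (A k)
      then have "x = 4*k+2 \<and> t = \<tau> (trip_A k) 0 \<or> x = 4 * (k + 1) \<or> x = 4*k"
        by (auto simp: trip_tedges_gate)
      moreover have "x \<noteq> 4 * (k + 1)" "x \<noteq> 4*k" "x = 4*k+2 \<longrightarrow> x = 4*c+2 \<and> k = c"
        using x by presburger+
      ultimately have "x = 4*c+2" "t = \<tau> (trip_A c) 0"
        by auto
      then show ?thesis
        using I b AB by auto
    next
      case (B k)
      then have "x = 4*k+1 \<and> w = 4*k+2 \<and> t + d = \<tau> (trip_B k) 0 + 3 \<or> x = 4*k+3 \<or> x = 4 * (k + 1)"
        by (auto simp: trip_tedges_gate)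
      moreover have "x \<noteq> 4*k+3" "x \<noteq> 4 * (k + 1)" "x = 4*k+1 \<longrightarrow> k = c"
        using x by presburger+
      ultimately show ?thesis
        by auto
    qed (use I c in auto)
  qed
  then show ?thesis
    using c by auto
qed

text \<open>
  If gate \<open>m\<close> does not have \<open>A\<close> before \<open>B\<close>, nothing passes it from below: one gets stuck at \<open>v\<^sub>m\<close>.
\<close>

lemma closed_main_entrance:
  assumes path: "temporal_path (induced_temporal_graph (gate_net r) \<tau>) s p w"
    and s: "4*r < s" and c: "s mod r < m" and m: "m < r"
    and AB: "\<not> \<tau> (trip_A m) 0 + 3 \<le> \<tau> (trip_B m) 0"
  shows "w \<le> 4*r"
proof -
  \<comment> \<open>Gates below \<open>m\<close> stay within \<open>{..4*m}\<close>. From there the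
    only way up is to \<open>4*m+3\<close> by the last edge of \<open>trip_A m\<close>, too late for
    the first edge of \<open>trip_B m\<close>.\<close>
  let ?I = "\<lambda>x b. x \<le> 4*m \<or> x = 4*m+3 \<and> b \<ge> \<tau> (trip_A m) 0 + 3"
  have "?I w (arrival_time (last p))"
    using path
  proof (rule temporal_path_invariant)
    fix w t d assume "(s, w, t, d) \<in> tedges (induced_temporal_graph (gate_net r) \<tau>)"
    then show "?I w (t + d)"
      by (cases rule: gate_tedge_cases) (use s c in \<open>auto simp: trip_tedges_gate\<close>)
  next
    fix x b w t d
    assume I: "?I x b" and b: "b \<le> t"
      and "(x, w, t, d) \<in> tedges (induced_temporal_graph (gate_net r) \<tau>)"
    from this(3) show "?I w (t + d)"
    proof (cases rule: gate_tedge_cases)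
      case (A k)
      consider "k < m" | "k = m" | "k > m" by linarith
      then show ?thesis
        using A I b AB by cases (auto simp: trip_tedges_gate)
    next
      case (B k)
      consider "k < m" | "k = m" | "k > m" by linarith
      then show ?thesis
        using B I b AB by cases (auto simp: trip_tedges_gate)
    qed (use I m in auto)
  qed
  then show ?thesis
    using m by auto
qed

text \<open>Let \<open>M\<close> be the gates closed to chain traffic. A class outside
  \<open>M\<close> fails at its own side entrance, a class in \<open>M\<close> below
  \<open>Max M\<close> fails at gate \<open>Max M\<close>. If \<open>M\<close> is empty,
  \<open>Max M\<close> is arbitrary, but then every side entrance is closed.\<close>

lemma ex_unique_open_class:
  assumes "r > 3"
  shows "\<exists>c. \<forall>s w p. 4*r < s \<longrightarrow> 4*r < w \<longrightarrow>
           temporal_path (induced_temporal_graph (gate_net r) \<tau>) s p w \<longrightarrow> s mod r = c"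
proof -
  define M where "M = {t. t < r \<and> \<not> \<tau> (trip_A t) 0 + 3 \<le> \<tau> (trip_B t) 0}"
  have fin: "finite M"
    by (simp add: M_def)
  have "s mod r = Max M"
    if s: "4*r < s" and w: "4*r < w"
      and p: "temporal_path (induced_temporal_graph (gate_net r) \<tau>) s p w" for s w p
  proof (rule ccontr)
    assume ne: "s mod r \<noteq> Max M"
    have c: "s mod r < r"
      using assms by simp
    show False
    proof (cases "s mod r \<in> M")
      case True
      then have "s mod r < Max M" "Max M \<in> M"
        using ne Max_ge[OF fin True] Max_in[OF fin] True by (auto simp: less_le)
      then show False
        using closed_main_entrance[OF p s] w by (auto simp: M_def)
    next
      case False
      then show False
        using closed_side_entrance[OF p s refl c] w c by (auto simp: M_def)
    qed
  qed
  then show ?thesis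
    by blast
qed

lemma card_residue_class:
  assumes "r > (0::nat)"
  shows "card {s. s < r * k \<and> s mod r = c} \<le> k"
proof -
  have "{s. s < r * k \<and> s mod r = c} \<subseteq> (\<lambda>q. r * q + c) ` {..<k}"
  proof
    fix s assume "s \<in> {s. s < r * k \<and> s mod r = c}"
    then have "s = r * (s div r) + c" "s div r < k"
      using assms by (auto simp: less_mult_imp_div_less mult.commute)
    then show "s \<in> (\<lambda>q. r * q + c) ` {..<k}"
      by blast
  qed
  from card_mono[OF _ this] have "card {s. s < r * k \<and> s mod r = c} \<le> card ((\<lambda>q. r * q + c) ` {..<k})"
    by simp
  also have "\<dots> \<le> k"
    using card_image_le[of "{..<k}"] by simp
  finally show ?thesis .
qed

text \<open>Two hub strips of \<open>(4*r+1)*n\<close> pairs, the diagonal, and at most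
  \<open>r+2\<close> sources in the open class:
  \<open>2*(4*r+1) + 1 + (r+2) = 9*r + 5\<close>.\<close>

lemma reachability_gate_net:
  assumes "r > 3"
  shows "reachability (gate_net r) \<tau> \<le> (9 * r + 5) * (r^2 + 2*r)"
proof -
  define n where "n = r^2 + 2*r"
  have n: "n = r * (r + 2)"
    by (simp add: n_def power2_eq_square)
  obtain c where c: "\<And>s w p. 4*r < s \<Longrightarrow> 4*r < w \<Longrightarrow>
      temporal_path (induced_temporal_graph (gate_net r) \<tau>) s p w \<Longrightarrow> s mod r = c"
    using ex_unique_open_class[OF assms] by metis
  let ?H = "{..4*r}" and ?V = "{..<n}" and ?K = "{s. s < n \<and> s mod r = c}"
  let ?D = "(\<lambda>a. (a, a)) ` ?V"
  have "{(a, b). a \<in> nodes (graph (gate_net r)) \<and> b \<in> nodes (graph (gate_net r)) \<and>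
           temporally_reachable (induced_temporal_graph (gate_net r) \<tau>) a b}
        \<subseteq> ?H \<times> ?V \<union> ?V \<times> ?H \<union> ?D \<union> ?K \<times> ?V" (is "?R \<subseteq> ?U")
    using c by (fastforce simp: gate_net_def n_def temporally_reachable_def not_le)
  then have "reachability (gate_net r) \<tau> \<le> card ?U"
    unfolding reachability_def by (intro card_mono) auto
  also have "\<dots> \<le> card (?H \<times> ?V) + card (?V \<times> ?H) + card ?D + card (?K \<times> ?V)"
    by (meson add_mono card_Un_le order_refl order_trans)
  also have "\<dots> \<le> (4*r+1) * n + n * (4*r+1) + n + (r+2) * n"
  proof -
    have "card ?K \<le> r + 2"
      using card_residue_class[of r "r+2" c] assms n by simp
    then have "card ?K * n \<le> (r + 2) * n"
      by (rule mult_right_mono) simp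
    moreover have "card ?D \<le> n"
      using card_image_le[of ?V "\<lambda>a. (a, a)"] by simp
    ultimately show ?thesis
      by (simp add: card_cartesian_product algebra_simps)
  qed
  also have "\<dots> \<le> (9 * r + 5) * n"
    by (simp add: algebra_simps)
  finally show ?thesis
    by (simp add: n_def)
qed

theorem theorem5:
  "\<exists>C::real. C > 0 \<and>
     (\<forall>r::nat. r > 3 \<longrightarrow>
        (\<exists>N :: nat trip_net.
           trip_network N \<and> strongly_temporalisable N \<and>
           card (nodes (graph N)) = r^2 + 2 * r \<and>
           (\<forall>\<tau>. real (reachability N \<tau>) \<le> C * real (card (nodes (graph N))) powr (3/2))))"
proof (intro exI[of _ "11::real"] conjI allI impI)
  fix r :: nat assume r: "r > 3"
  have card: "card (nodes (graph (gate_net r))) = r^2 + 2 * r"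
    by (simp add: gate_net_def)
  have "real (reachability (gate_net r) \<tau>) \<le> 11 * real (r^2 + 2 * r) powr (3/2)" for \<tau>
  proof -
    define n where "n = real (r^2 + 2 * r)"
    have "n > 0"
      using r by (simp add: n_def add_pos_pos)
    have "real r \<le> sqrt n"
      by (rule real_le_rsqrt) (simp add: n_def)
    have "real (reachability (gate_net r) \<tau>) \<le> real ((9 * r + 5) * (r^2 + 2*r))"
      using reachability_gate_net[OF r] of_nat_mono by blast
    also have "\<dots> = (9 * real r + 5) * n"
      by (simp add: n_def)
    \<comment> \<open>Since \<open>r > 3\<close>, \<open>5 \<le> 2*r\<close>, which gives the
      constant 11.\<close>
    also have "\<dots> \<le> (11 * sqrt n) * n"
      using r \<open>real r \<le> sqrt n\<close> \<open>n > 0\<close> by (intro mult_right_mono) auto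
    also have "\<dots> = 11 * (n powr (1/2) * n powr 1)"
      using \<open>n > 0\<close> by (simp add: powr_half_sqrt)
    also have "\<dots> = 11 * n powr (3/2)"
      by (simp only: powr_add[symmetric]) simp
    finally show ?thesis
      by (simp add: n_def)
  qed
  then show "\<exists>N :: nat trip_net. trip_network N \<and> strongly_temporalisable N \<and>
      card (nodes (graph N)) = r^2 + 2 * r \<and>
      (\<forall>\<tau>. real (reachability N \<tau>) \<le> 11 * real (card (nodes (graph N))) powr (3/2))"
    using trip_network_gate_net[OF r] strongly_temporalisable_gate_net[OF r] card
    by (intro exI[of _ "gate_net r"]) simp
qed simp

end
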